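(* Let $n\in\{2,3\}$, let $\Omega\subset\mathbb{R}^n$ be a bounded open domain satisfying the cone condition, let $\epsilon>0$, $\tau>0$, and let $\varphi^{k-1}\in H^1(\Omega)$ be the given phase field from the previous time instance. For a (large) parameter $s>0$ let $(\varphi^s,\mu^s)\in H^1(\Omega)\times H^1(\Omega)$ be the unique solution of the relaxed time-discrete Cahn--Hilliard system $$(\varphi^s,v)+\tau(\nabla\mu^s,\nabla v)=(\varphi^{k-1},v)\quad\forall v\in H^1(\Omega),$$ $$\epsilon(\nabla\varphi^s,\nabla v)+\epsilon^{-1}(s\lambda(\varphi^s),v)-\epsilon^{-1}(\varphi^{k-1},v)=(\mu^s,v)\quad\forall v\in H^1(\Omega),$$ where $\lambda(\varphi)=\max(0,\varphi-1)+\min(0,\varphi+1)$. Let $s_0>0$. Assume the following structural condition: there exists $0<K<\infty$, independent of $x$, $R$ and $s$, such that for all $x\in\Omega$, all $R>0$ and all $s\ge s_0$ $$\int_{B_R(x)\cap\Omega} s\,|\lambda(\varphi^s)|\,dx\le K R^n,$$ where $B_R(x)$ is the ball of radius $R$ centred at $x$. Then, for $0<\beta<2-\frac n2$, there is a constant $C=C(\Omega,n,\beta,K)>0$, independent of $s$, such that for all $s\ge s_0$ $$\|\lambda(\varphi^s)\|_{L^\infty(\Omega)}\le C\,s^{-1}.$$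
   Context: $(\cdot,\cdot)$ denotes the $L^2(\Omega)$ inner product (for scalar or vector valued functions). $H^1(\Omega)=W^{1,2}(\Omega)$ is the usual Sobolev space. $\Omega$ satisfies the cone condition if there is a fixed finite cone such that every $x\in\Omega$ is the vertex of a cone contained in $\Omega$ and congruent to the fixed one. The system is the Moreau--Yosida relaxation (relaxation parameter $s$, regarded as large) of one time step, of size $\tau$, of the Cahn--Hilliard system with double-obstacle free energy; $\epsilon$ is the interface parameter. Existence and uniqueness of the solution for each $s$ is quoted from the literature. The function $\lambda(\varphi^s)$ measures the violation of the constraint $|\varphi^s|\le1$. The parameter $\beta$ is a Hölder exponent of $\varphi^s$, coming from the embedding $H^2(\Omega)\hookrightarrow C^{0,\beta}(\overline\Omega)$ for $\beta<2-\frac n2$. *)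

theory Defs
  imports "HOL-Analysis.Analysis" "HOL-Probability.Essential_Supremum"
begin

text \<open>
  Functions on a domain \<open>\<Omega>\<close> are total functions on \<open>real ^ 'n\<close> whose values outside \<open>\<Omega>\<close> are
  irrelevant. Elements of \<open>L\<^sup>2\<close> and \<open>H\<^sup>1\<close> are represented by functions, not by classes modulo
  null sets; all notions below depend only on the class.
\<close>

definition domain :: "(real ^ 'n) set \<Rightarrow> bool" where
  "domain \<Omega> \<longleftrightarrow> open \<Omega> \<and> connected \<Omega> \<and> \<Omega> \<noteq> {}"

subsection \<open>The cone condition\<close>

text \<open>
  \<open>finite_cone v \<rho> \<kappa>\<close> is the finite cone with vertex \<open>0\<close>, axis direction \<open>v\<close>, height \<open>\<rho>\<close> and
  aperture angle \<open>\<kappa>\<close>: it consists of \<open>0\<close> and of all \<open>y\<close> with \<open>0 < |y| \<le> \<rho>\<close> that make an angle of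
  at most \<open>\<kappa> / 2\<close> with \<open>v\<close>.
\<close>

definition finite_cone :: "real ^ 'n \<Rightarrow> real \<Rightarrow> real \<Rightarrow> (real ^ 'n) set" where
  "finite_cone v \<rho> \<kappa> =
     {y. y = 0 \<or> (0 < norm y \<and> norm y \<le> \<rho> \<and> arccos ((y \<bullet> v) / (norm y * norm v)) \<le> \<kappa> / 2)}"

text \<open>
  A cone congruent to a cone with vertex \<open>0\<close> and having vertex \<open>x\<close> is its image under a linear
  isometry followed by the translation by \<open>x\<close>.
\<close>

definition cone_condition :: "(real ^ 'n) set \<Rightarrow> bool" where
  "cone_condition \<Omega> \<longleftrightarrow>
     (\<exists>(v :: real ^ 'n) \<rho> \<kappa>. v \<noteq> 0 \<and> 0 < \<rho> \<and> 0 < \<kappa> \<and> \<kappa> \<le> pi \<and>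
       (\<forall>x\<in>\<Omega>. \<exists>T :: real ^ 'n \<Rightarrow> real ^ 'n.
          orthogonal_transformation T \<and> (\<lambda>y. x + T y) ` finite_cone v \<rho> \<kappa> \<subseteq> \<Omega>))"

subsection \<open>Lebesgue spaces\<close>

definition L2 :: "(real ^ 'n) set \<Rightarrow> (real ^ 'n \<Rightarrow> 'b :: euclidean_space) set" where
  "L2 \<Omega> = {f \<in> borel_measurable (lebesgue_on \<Omega>). integrable (lebesgue_on \<Omega>) (\<lambda>x. (norm (f x))\<^sup>2)}"

text \<open>For scalar functions, \<open>f x \<bullet> g x\<close> is the product of reals.\<close>

definition L2_inner ::
    "(real ^ 'n) set \<Rightarrow> (real ^ 'n \<Rightarrow> 'b :: euclidean_space) \<Rightarrow> (real ^ 'n \<Rightarrow> 'b) \<Rightarrow> real" where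
  "L2_inner \<Omega> f g = (\<integral>x. f x \<bullet> g x \<partial>lebesgue_on \<Omega>)"

definition Linf_norm :: "(real ^ 'n) set \<Rightarrow> (real ^ 'n \<Rightarrow> real) \<Rightarrow> ereal" where
  "Linf_norm \<Omega> f = esssup (lebesgue_on \<Omega>) (\<lambda>x. ereal \<bar>f x\<bar>)"

subsection \<open>The Sobolev space \<open>H\<^sup>1\<close>\<close>

definition partial_deriv :: "'n \<Rightarrow> (real ^ 'n \<Rightarrow> real) \<Rightarrow> real ^ 'n \<Rightarrow> real" where
  "partial_deriv i f x = frechet_derivative f (at x) (axis i 1)"

fun Ck :: "nat \<Rightarrow> (real ^ 'n \<Rightarrow> real) \<Rightarrow> bool" where
  "Ck 0 f \<longleftrightarrow> continuous_on UNIV f"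
| "Ck (Suc k) f \<longleftrightarrow> (\<forall>x. f differentiable (at x)) \<and> (\<forall>i. Ck k (partial_deriv i f))"

definition test_function :: "(real ^ 'n) set \<Rightarrow> (real ^ 'n \<Rightarrow> real) \<Rightarrow> bool" where
  "test_function \<Omega> \<psi> \<longleftrightarrow>
     (\<forall>k. Ck k \<psi>) \<and> compact (closure {x. \<psi> x \<noteq> 0}) \<and> closure {x. \<psi> x \<noteq> 0} \<subseteq> \<Omega>"

text \<open>Only used for \<open>u\<close> and \<open>G\<close> in \<open>L\<^sup>2\<close>, so that all integrals exist.\<close>

definition weak_gradient ::
    "(real ^ 'n) set \<Rightarrow> (real ^ 'n \<Rightarrow> real) \<Rightarrow> (real ^ 'n \<Rightarrow> real ^ 'n) \<Rightarrow> bool" where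
  "weak_gradient \<Omega> u G \<longleftrightarrow>
     (\<forall>\<psi> i. test_function \<Omega> \<psi> \<longrightarrow>
        (\<integral>x. u x * partial_deriv i \<psi> x \<partial>lebesgue_on \<Omega>) = - (\<integral>x. G x $ i * \<psi> x \<partial>lebesgue_on \<Omega>))"

definition H1 :: "(real ^ 'n) set \<Rightarrow> (real ^ 'n \<Rightarrow> real) set" where
  "H1 \<Omega> = {u \<in> L2 \<Omega>. \<exists>G\<in>L2 \<Omega>. weak_gradient \<Omega> u G}"

text \<open>
  For \<open>u\<close> in \<open>H\<^sup>1\<close> the weak gradient is unique up to a null set, so the choice does not affect
  \<open>L\<^sup>2\<close> inner products.
\<close>

definition grad :: "(real ^ 'n) set \<Rightarrow> (real ^ 'n \<Rightarrow> real) \<Rightarrow> real ^ 'n \<Rightarrow> real ^ 'n" where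
  "grad \<Omega> u = (SOME G. G \<in> L2 \<Omega> \<and> weak_gradient \<Omega> u G)"

subsection \<open>The relaxed Cahn--Hilliard system\<close>

definition violation :: "real \<Rightarrow> real" where
  "violation r = max 0 (r - 1) + min 0 (r + 1)"

text \<open>
  One time step of size \<open>\<tau>\<close>, starting from \<open>\<phi>0\<close>, with interface parameter \<open>\<epsilon>\<close> and relaxation
  parameter \<open>s\<close>.
\<close>

definition relaxed_CH_solution ::
    "(real ^ 'n) set \<Rightarrow> real \<Rightarrow> real \<Rightarrow> (real ^ 'n \<Rightarrow> real) \<Rightarrow> real \<Rightarrow>
     (real ^ 'n \<Rightarrow> real) \<Rightarrow> (real ^ 'n \<Rightarrow> real) \<Rightarrow> bool" where
  "relaxed_CH_solution \<Omega> \<epsilon> \<tau> \<phi>0 s \<phi> \<mu> \<longleftrightarrow>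
     \<phi> \<in> H1 \<Omega> \<and> \<mu> \<in> H1 \<Omega> \<and>
     (\<forall>v\<in>H1 \<Omega>.
        L2_inner \<Omega> \<phi> v + \<tau> * L2_inner \<Omega> (grad \<Omega> \<mu>) (grad \<Omega> v) = L2_inner \<Omega> \<phi>0 v) \<and>
     (\<forall>v\<in>H1 \<Omega>.
        \<epsilon> * L2_inner \<Omega> (grad \<Omega> \<phi>) (grad \<Omega> v)
          + inverse \<epsilon> * L2_inner \<Omega> (\<lambda>x. s * violation (\<phi> x)) v
          - inverse \<epsilon> * L2_inner \<Omega> \<phi>0 v
        = L2_inner \<Omega> \<mu> v)"

definition structural_condition ::
    "(real ^ 'n) set \<Rightarrow> real \<Rightarrow> real \<Rightarrow> (real \<Rightarrow> real ^ 'n \<Rightarrow> real) \<Rightarrow> bool" where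
  "structural_condition \<Omega> s0 K \<phi> \<longleftrightarrow>
     (\<forall>x\<in>\<Omega>. \<forall>R>0. \<forall>s\<ge>s0.
        (\<integral>y. s * \<bar>violation (\<phi> s y)\<bar> \<partial>lebesgue_on (ball x R \<inter> \<Omega>)) \<le> K * R ^ CARD('n))"

end

theory Submission
  imports Defs
begin

text \<open>
  The structural condition is a bound on mean values: since it holds for balls of \<^emph>\<open>every\<close> radius
  and the right-hand side scales like the volume of the ball, the density \<open>s * \<bar>violation (\<phi> s x)\<bar>\<close>
  has means over small sets shrinking nicely to \<open>x\<close> bounded by a multiple of \<open>K\<close> that depends only
  on the dimension. By Lebesgue's differentiation theorem these means converge to the density itself
  at almost every \<open>x\<close>, so the density is essentially bounded by the same multiple of \<open>K\<close>; dividing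
  by \<open>s\<close> gives the rate \<open>1 / s\<close>, with \<open>C = K * (2 * n) ^ n\<close> in dimension \<open>n\<close>.

  Two points need care. The structural condition says something about the density only where the
  latter is integrable, the integral of a non-integrable function being \<open>0\<close> by convention;
  integrability follows from \<open>\<phi> s \<in> L2 \<Omega>\<close>, the boundedness of \<open>\<Omega>\<close> and \<open>\<bar>violation r\<bar> \<le> \<bar>r\<bar>\<close>. And the
  differentiation theorem \<open>integrable_ccontinuous_explicit\<close> speaks of means over cubes with a corner
  at \<open>x\<close>, not over balls; enclosing such a cube in a ball costs the factor \<open>(2 * n) ^ n\<close> in
  \<open>AE_le_of_integral_ball_le\<close>.
\<close>

text \<open>
  The cube has diameter at most \<open>n * h\<close> in dimension \<open>n\<close>, by comparison with the \<open>l\<^sup>1\<close> norm; doubling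
  the radius gives the strict inequality that the open ball requires.
\<close>

lemma cbox_corner_subset_ball:
  fixes x :: "real ^ 'n"
  assumes "0 < h"
  shows "cbox x (x + h *\<^sub>R One) \<subseteq> ball x (2 * real CARD('n) * h)"
proof
  fix y assume y: "y \<in> cbox x (x + h *\<^sub>R One)"
  have "norm (y - x) \<le> (\<Sum>b\<in>Basis. \<bar>(y - x) \<bullet> b\<bar>)"
    by (rule norm_le_l1)
  also have "\<dots> \<le> (\<Sum>b\<in>(Basis :: (real ^ 'n) set). h)"
    using y by (intro sum_mono) (auto simp: mem_box inner_diff_left inner_add_left)
  also have "\<dots> < 2 * real CARD('n) * h"
    using assms by simp
  finally show "y \<in> ball x (2 * real CARD('n) * h)"
    by (simp add: dist_norm norm_minus_commute)
qed

text \<open>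
  By Lebesgue's differentiation theorem, \<open>f\<close> is at almost every point the limit of its means over
  cubes of side \<open>h\<close> as \<open>h\<close> tends to \<open>0\<close>, and such a cube lies in a ball of radius \<open>2 * n * h\<close>. Since
  the theorem is about functions on the whole space, it is applied to the extension of \<open>f\<close> by zero;
  as \<open>f\<close> is nonnegative, passing from the cube to the ball can only increase the integral.
\<close>

lemma AE_le_of_integral_ball_le:
  fixes \<Omega> :: "(real ^ 'n) set" and f :: "real ^ 'n \<Rightarrow> real"
  assumes \<Omega>: "\<Omega> \<in> sets lebesgue"
    and f: "integrable (lebesgue_on \<Omega>) f" and nonneg: "\<And>x. x \<in> \<Omega> \<Longrightarrow> 0 \<le> f x"
    and ball: "\<And>x R. x \<in> \<Omega> \<Longrightarrow> 0 < R \<Longrightarrow>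
      (\<integral>y. f y \<partial>lebesgue_on (ball x R \<inter> \<Omega>)) \<le> K * R ^ CARD('n)"
  shows "AE x in lebesgue_on \<Omega>. f x \<le> K * (2 * real CARD('n)) ^ CARD('n)"
proof -
  let ?c = "K * (2 * real CARD('n)) ^ CARD('n)"
  define g where "g = (\<lambda>x. if x \<in> \<Omega> then f x else 0)"
  have g: "integrable lebesgue g"
    unfolding g_def using f \<Omega> by (simp add: Lebesgue_Measure.integrable_restrict_UNIV)
  have g_on: "integrable (lebesgue_on A) g" if "A \<in> sets lebesgue" for A
    using integrable_mult_indicator[OF that g] that by (simp add: integrable_restrict_space)
  have g_ion: "g integrable_on A" if "A \<in> sets lebesgue" for A
    using g_on[OF that] that by (rule integrable_on_lebesgue_on)
  have g_nonneg: "0 \<le> g x" for x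
    using nonneg by (simp add: g_def)
  obtain N where N: "negligible N"
    and diff: "\<And>x e. x \<notin> N \<Longrightarrow> 0 < e \<Longrightarrow> \<exists>d>0. \<forall>h. 0 < h \<and> h < d \<longrightarrow>
      norm (integral (cbox x (x + h *\<^sub>R One)) g /\<^sub>R h ^ DIM(real ^ 'n) - g x) < e"
    by (rule integrable_ccontinuous_explicit[of g, OF g_ion[OF fmeasurableD[OF lmeasurable_cbox]]])
      (rule that)
  have le: "f x \<le> ?c" if x: "x \<in> \<Omega>" "x \<notin> N" for x
  proof (rule field_le_epsilon)
    fix e :: real assume "0 < e"
    obtain d where "0 < d" and d: "\<forall>h. 0 < h \<and> h < d \<longrightarrow>
      norm (integral (cbox x (x + h *\<^sub>R One)) g /\<^sub>R h ^ DIM(real ^ 'n) - g x) < e"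
      using diff[OF x(2) \<open>0 < e\<close>] by (elim exE conjE)
    define h where "h = d / 2"
    have h: "0 < h" "h < d"
      using \<open>0 < d\<close> by (auto simp: h_def)
    let ?Q = "cbox x (x + h *\<^sub>R One)" and ?B = "ball x (2 * real CARD('n) * h)"
    have B\<Omega>: "?B \<inter> \<Omega> \<in> sets lebesgue"
      by (rule sets.Int[OF fmeasurableD[OF lmeasurable_ball] \<Omega>])
    have "integral ?Q g \<le> integral ?B g"
      by (rule integral_subset_le[OF cbox_corner_subset_ball[OF h(1)]])
        (simp_all add: g_ion fmeasurableD g_nonneg)
    also have "\<dots> = integral (?B \<inter> \<Omega>) f"
      unfolding g_def by (simp add: Henstock_Kurzweil_Integration.integral_restrict_Int Int_commute)
    also have "\<dots> = (\<integral>y. f y \<partial>lebesgue_on (?B \<inter> \<Omega>))"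
    proof (rule lebesgue_integral_eq_integral[symmetric, OF _ B\<Omega>])
      show "integrable (lebesgue_on (?B \<inter> \<Omega>)) f"
        using g_on[OF B\<Omega>]
        by (rule Bochner_Integration.integrable_cong[THEN iffD1, rotated 2]) (auto simp: g_def)
    qed
    also have "\<dots> \<le> K * (2 * real CARD('n) * h) ^ CARD('n)"
      using x(1) h by (intro ball) auto
    also have "\<dots> = ?c * h ^ CARD('n)"
      by (simp add: power_mult_distrib)
    finally have "integral ?Q g /\<^sub>R h ^ DIM(real ^ 'n) \<le> ?c"
      using h(1) by (simp add: field_simps)
    moreover have "g x = f x"
      using x(1) by (simp add: g_def)
    ultimately show "f x \<le> ?c + e"
      using d[rule_format, OF conjI[OF h]] unfolding real_norm_def by linarith
  qed
  have "AE x in lebesgue. x \<notin> N"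
    using N by (intro AE_not_in) (simp add: negligible_iff_null_sets)
  then show ?thesis
    using le \<Omega> by (auto simp: AE_restrict_space_iff)
qed

lemma L2_integrable:
  fixes \<Omega> :: "(real ^ 'n) set" and u :: "real ^ 'n \<Rightarrow> real"
  assumes "\<Omega> \<in> lmeasurable" and "u \<in> L2 \<Omega>"
  shows "integrable (lebesgue_on \<Omega>) u"
proof -
  interpret finite_measure "lebesgue_on \<Omega>"
    using assms(1) by (rule finite_measure_lebesgue_on)
  show ?thesis
    by (rule square_integrable_imp_integrable) (use assms(2) in \<open>simp_all add: L2_def\<close>)
qed

lemma abs_violation_le: "\<bar>violation r\<bar> \<le> \<bar>r\<bar>"
  by (auto simp: violation_def)

lemma borel_measurable_violation [measurable]: "violation \<in> borel_measurable borel"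
  unfolding violation_def[abs_def] by measurable

theorem theorem8:
  fixes \<Omega> :: "(real ^ 'n) set" and \<beta> K :: real
  assumes "CARD('n) \<in> {2, 3}"
    and "domain \<Omega>" and "bounded \<Omega>" and "cone_condition \<Omega>"
    and "0 < \<beta>" and "\<beta> < 2 - real CARD('n) / 2"
    and "0 < K"
  shows "\<exists>C>0. \<forall>\<epsilon>>0. \<forall>\<tau>>0. \<forall>\<phi>0\<in>H1 \<Omega>. \<forall>s0>0.
    \<forall>(\<phi> :: real \<Rightarrow> real ^ 'n \<Rightarrow> real) (\<mu> :: real \<Rightarrow> real ^ 'n \<Rightarrow> real).
      (\<forall>s\<ge>s0. relaxed_CH_solution \<Omega> \<epsilon> \<tau> \<phi>0 s (\<phi> s) (\<mu> s)) \<longrightarrow>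
      structural_condition \<Omega> s0 K \<phi> \<longrightarrow>
      (\<forall>s\<ge>s0. Linf_norm \<Omega> (\<lambda>x. violation (\<phi> s x)) \<le> ereal (C * inverse s))"
proof -
  define C where "C = K * (2 * real CARD('n)) ^ CARD('n)"
  have "0 < C"
    using \<open>0 < K\<close> by (simp add: C_def)
  have \<Omega>: "\<Omega> \<in> lmeasurable"
    using assms(2,3) by (auto simp: domain_def intro: lmeasurable_open)
  have bound: "Linf_norm \<Omega> (\<lambda>x. violation (u x)) \<le> ereal (C * inverse s)"
    if "0 < s" and "u \<in> L2 \<Omega>"
      and dens: "\<And>x R. x \<in> \<Omega> \<Longrightarrow> 0 < R \<Longrightarrow>
        (\<integral>y. s * \<bar>violation (u y)\<bar> \<partial>lebesgue_on (ball x R \<inter> \<Omega>)) \<le> K * R ^ CARD('n)"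
    for s and u :: "real ^ 'n \<Rightarrow> real"
  proof -
    have u: "integrable (lebesgue_on \<Omega>) u"
      using \<Omega> that(2) by (rule L2_integrable)
    have [measurable]: "u \<in> borel_measurable (lebesgue_on \<Omega>)"
      using u by simp
    have "integrable (lebesgue_on \<Omega>) (\<lambda>x. violation (u x))"
      using u by (rule Bochner_Integration.integrable_bound) (auto simp: abs_violation_le)
    then have int: "integrable (lebesgue_on \<Omega>) (\<lambda>x. s * \<bar>violation (u x)\<bar>)"
      by simp
    have "AE x in lebesgue_on \<Omega>. s * \<bar>violation (u x)\<bar> \<le> C"
      unfolding C_def
      by (rule AE_le_of_integral_ball_le[OF fmeasurableD[OF \<Omega>] int _ dens]) (use \<open>0 < s\<close> in auto)
    then have "AE x in lebesgue_on \<Omega>. ereal \<bar>violation (u x)\<bar> \<le> ereal (C * inverse s)"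
      by eventually_elim (use \<open>0 < s\<close> in \<open>simp add: field_simps\<close>)
    then show ?thesis
      unfolding Linf_norm_def by (intro esssup_I) measurable
  qed
  have "Linf_norm \<Omega> (\<lambda>x. violation (\<phi> s x)) \<le> ereal (C * inverse s)"
    if "0 < s0" "\<forall>s\<ge>s0. relaxed_CH_solution \<Omega> \<epsilon> \<tau> \<phi>0 s (\<phi> s) (\<mu> s)"
      "structural_condition \<Omega> s0 K \<phi>" "s0 \<le> s"
    for \<epsilon> \<tau> \<phi>0 s0 s and \<phi> \<mu> :: "real \<Rightarrow> real ^ 'n \<Rightarrow> real"
    using that by (intro bound) (auto simp: relaxed_CH_solution_def H1_def structural_condition_def)
  then show ?thesis
    using \<open>0 < C\<close> by blast
qed

end
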